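(* There exist a finite solvable group $G$ and a character $\chi\in\mathrm{Irr}(G)$ such that there is no element $g\in G$ with $\pi(\mathrm{cod}(\chi))\subseteq\pi(o(g))$.
   Context: All groups are finite and all characters are over the complex numbers. $\mathrm{Irr}(G)$ denotes the set of irreducible complex characters of $G$. For a character $\chi$ of $G$, the codegree of $\chi$ is $\mathrm{cod}(\chi)=|G:\mathrm{Ker}\,\chi|/\chi(1)$, where $\mathrm{Ker}\,\chi=\{g\in G:\chi(g)=\chi(1)\}$. For a positive integer $n$, $\pi(n)$ denotes the set of prime divisors of $n$, and $o(g)$ denotes the order of the element $g$. *)

theory Defs
  imports
    "HOL-Algebra.Solvable_Groups"
    "HOL-Algebra.Multiplicative_Group"
    "HOL-Computational_Algebra.Primes"
    "Jordan_Normal_Form.VS_Connect"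
begin

text \<open>Complex matrix representations of degree \<open>n\<close>: homomorphisms into the group
  of invertible complex \<open>n \<times> n\<close> matrices.\<close>

definition is_representation ::
    "('a, 'b) monoid_scheme \<Rightarrow> nat \<Rightarrow> ('a \<Rightarrow> complex mat) \<Rightarrow> bool" where
  "is_representation G n \<rho> \<longleftrightarrow> \<rho> \<in> hom G (units_of (ring_mat TYPE(complex) n ()))"

definition is_irreducible_representation ::
    "('a, 'b) monoid_scheme \<Rightarrow> nat \<Rightarrow> ('a \<Rightarrow> complex mat) \<Rightarrow> bool" where
  "is_irreducible_representation G n \<rho> \<longleftrightarrow>
     is_representation G n \<rho> \<and> n > 0 \<and>
     (\<forall>W. subspace class_ring W (module_vec TYPE(complex) n) \<and>
          (\<forall>g \<in> carrier G. \<forall>w \<in> W. \<rho> g *\<^sub>v w \<in> W)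
        \<longrightarrow> W = {0\<^sub>v n} \<or> W = carrier_vec n)"

definition mat_trace :: "'a :: comm_monoid_add mat \<Rightarrow> 'a" where
  "mat_trace A = (\<Sum>i < dim_row A. A $$ (i, i))"

text \<open>Characters are restricted to the carrier, so that equality of functions in
  \<open>Irr G\<close> is equality of characters.\<close>

definition character_of ::
    "('a, 'b) monoid_scheme \<Rightarrow> ('a \<Rightarrow> complex mat) \<Rightarrow> 'a \<Rightarrow> complex" where
  "character_of G \<rho> = (\<lambda>g \<in> carrier G. mat_trace (\<rho> g))"

definition Irr :: "('a, 'b) monoid_scheme \<Rightarrow> ('a \<Rightarrow> complex) set" where
  "Irr G = {character_of G \<rho> | n \<rho>. is_irreducible_representation G n \<rho>}"

definition char_kernel :: "('a, 'b) monoid_scheme \<Rightarrow> ('a \<Rightarrow> complex) \<Rightarrow> 'a set" where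
  "char_kernel G \<chi> = {g \<in> carrier G. \<chi> g = \<chi> \<one>\<^bsub>G\<^esub>}"

text \<open>The quotient is taken in \<open>\<complex>\<close>, not by truncating division. For an irreducible character
  of a finite group it is a positive integer, because \<open>\<chi>(1)\<close> divides
  \<open>|G : Ker \<chi>|\<close>; the description selects that natural number.\<close>

definition codegree :: "('a, 'b) monoid_scheme \<Rightarrow> ('a \<Rightarrow> complex) \<Rightarrow> nat" where
  "codegree G \<chi> =
     (THE c. (of_nat c :: complex) =
        of_nat (card (rcosets\<^bsub>G\<^esub> (char_kernel G \<chi>))) / \<chi> \<one>\<^bsub>G\<^esub>)"

end

theory Submission
  imports Defs "HOL-Algebra.Weak_Morphisms" "HOL-Combinatorics.Cycles"
begin

text \<open>The example is the wreath product \<open>C\<^sub>5 wr S\<^sub>4\<close> of order \<open>5\<^sup>4 \<cdot> 24\<close>, realised as the group of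
  monomial \<open>4 \<times> 4\<close> matrices whose nonzero entries are fifth roots of unity, with \<open>\<chi>\<close> the trace.
  The character is faithful of degree 4, so its codegree is
  \<open>5\<^sup>4 \<cdot> 24 / 4 = 3750 = 2 \<cdot> 3 \<cdot> 5\<^sup>4\<close>, and an element \<open>g\<close> whose order involves all its primes would
  have order divisible by 6. But every permutation of four points satisfies \<open>\<sigma>\<^sup>3 = 1\<close> or
  \<open>\<sigma>\<^sup>4 = 1\<close>; correspondingly \<open>g\<^sup>3\<close> or \<open>g\<^sup>4\<close> is a diagonal matrix of fifth roots of unity, so the
  order of \<open>g\<close> divides 15 or 20 (\<open>G54_pow\<close>). The codegree keeps both primes 2 and 3 because the
  stabiliser \<open>S\<^sub>3\<close> of a point contains both, without having elements of order 6.

  The trace is irreducible because a nonzero invariant subspace contains a standard basis vector,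
  namely a multiple of the difference of a vector and its image under a diagonal matrix with one
  entry different from 1, and then contains all of them by transitivity
  (\<open>monomial_group_irreducible\<close>). It is faithful because the trace is a sum of at most four
  complex numbers of modulus 1, which is 4 only for the identity (\<open>monomial_group_faithful\<close>). The group is solvable because the
  monomial matrices over \<open>S\<^sub>4 > A\<^sub>4 > V\<^sub>4 > 1\<close> form a chain of subgroups each of which
  contains the commutators of the preceding one (\<open>G54_solvable\<close>), ending in the abelian group of
  diagonal matrices. Finally the finite matrix group is copied onto a set of natural numbers, and
  the isomorphism back onto it is the representation affording \<open>\<chi>\<close>.\<close>

section \<open>Group-theoretic preliminaries\<close>

lemma (in group) solvable_seq_of_commutators:
  assumes H: "subgroup H G" and K: "solvable_seq G K"
    and comm: "\<And>x y. x \<in> H \<Longrightarrow> y \<in> H \<Longrightarrow> x \<otimes> y \<otimes> inv x \<otimes> inv y \<in> K"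
  shows "solvable_seq G H"
proof -
  have "derived G H \<subseteq> K"
    unfolding derived_def
    by (rule generate_subgroup_incl) (use comm solvable_imp_subgroup[OF K] in auto)
  moreover obtain n where "(derived G ^^ n) K = {\<one>}"
    using solvable_imp_trivial_derived_seq[OF K] by blast
  ultimately have "(derived G ^^ Suc n) H \<subseteq> {\<one>}"
    using mono_exp_of_derived[of "derived G H" K n] by (simp add: funpow_swap1)
  moreover have "\<one> \<in> (derived G ^^ Suc n) H"
    using subgroup.one_closed[OF exp_of_derived_is_subgroup[OF H]] .
  ultimately show ?thesis
    by (intro trivial_derived_seq_imp_solvable[OF H, of "Suc n"]) auto
qed

lemma finite_group_copy_on_nat:
  assumes "group H" "finite (carrier H)"
  shows "\<exists>(G :: nat monoid) \<phi>. group G \<and> \<phi> \<in> iso G H"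
proof -
  interpret H: group H by fact
  obtain f :: "_ \<Rightarrow> nat" where f: "inj_on f (carrier H)"
    using finite_imp_inj_to_nat_seg[OF assms(2)] by blast
  have iso: "f \<in> iso H (image_group f H)"
    using inj_imp_image_group_iso[OF f] .
  have "group (image_group f H)"
    using H.inj_imp_image_group_is_group[OF f] .
  then show ?thesis
    using H.iso_set_sym[OF iso] by blast
qed

lemma codegree_eqI:
  assumes "of_nat c * \<chi> \<one>\<^bsub>G\<^esub> = (of_nat (card (rcosets\<^bsub>G\<^esub> (char_kernel G \<chi>))) :: complex)"
    and "\<chi> \<one>\<^bsub>G\<^esub> \<noteq> 0"
  shows "codegree G \<chi> = c"
  unfolding codegree_def
proof (rule the_equality)
  show c: "of_nat c = of_nat (card (rcosets\<^bsub>G\<^esub> (char_kernel G \<chi>))) / \<chi> \<one>\<^bsub>G\<^esub>"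
    using assms by (simp add: nonzero_eq_divide_eq)
  fix d :: nat
  assume "of_nat d = of_nat (card (rcosets\<^bsub>G\<^esub> (char_kernel G \<chi>))) / \<chi> \<one>\<^bsub>G\<^esub>"
  with c have "(of_nat d :: complex) = of_nat c" by simp
  then show "d = c" by (simp only: of_nat_eq_iff)
qed

section \<open>Monomial matrices\<close>

text \<open>The monomial matrix of \<open>\<sigma>\<close> with weights \<open>z\<close> sends the basis vector \<open>e j\<close> to
  \<open>z j\<close> times \<open>e (\<sigma> j)\<close>. Only the values of \<open>z\<close> and \<open>\<sigma>\<close> below \<open>n\<close> matter.\<close>

definition monomial_mat :: "nat \<Rightarrow> (nat \<Rightarrow> complex) \<Rightarrow> (nat \<Rightarrow> nat) \<Rightarrow> complex mat" where
  "monomial_mat n z \<sigma> = mat n n (\<lambda>(i, j). if i = \<sigma> j then z j else 0)"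

lemma monomial_mat_carrier [simp]: "monomial_mat n z \<sigma> \<in> carrier_mat n n"
  by (simp add: monomial_mat_def)

lemma monomial_mat_dim [simp]:
  "dim_row (monomial_mat n z \<sigma>) = n" "dim_col (monomial_mat n z \<sigma>) = n"
  by (simp_all add: monomial_mat_def)

lemma permutes_lessThan_less: "\<sigma> permutes {..<n} \<Longrightarrow> i < n \<Longrightarrow> \<sigma> i < n" for n i :: nat
  using permutes_in_image[of \<sigma> "{..<n}" i] by simp

lemma monomial_mat_mult:
  assumes "\<tau> permutes {..<n}"
  shows "monomial_mat n z \<sigma> * monomial_mat n w \<tau> = monomial_mat n (\<lambda>j. z (\<tau> j) * w j) (\<sigma> \<circ> \<tau>)"
proof (rule eq_matI)
  fix i j assume "i < dim_row (monomial_mat n (\<lambda>j. z (\<tau> j) * w j) (\<sigma> \<circ> \<tau>))"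
    "j < dim_col (monomial_mat n (\<lambda>j. z (\<tau> j) * w j) (\<sigma> \<circ> \<tau>))"
  then have ij: "i < n" "j < n" by auto
  have "(monomial_mat n z \<sigma> * monomial_mat n w \<tau>) $$ (i, j) =
      (\<Sum>k<n. (if i = \<sigma> k then z k else 0) * (if k = \<tau> j then w j else 0))"
    using ij by (simp add: monomial_mat_def scalar_prod_def atLeast0LessThan)
  also have "\<dots> = (\<Sum>k<n. if k = \<tau> j then (if i = \<sigma> k then z k else 0) * w j else 0)"
    by (rule sum.cong) auto
  also have "\<dots> = (if i = \<sigma> (\<tau> j) then z (\<tau> j) else 0) * w j"
    using permutes_lessThan_less[OF assms ij(2)] by simp
  finally show "(monomial_mat n z \<sigma> * monomial_mat n w \<tau>) $$ (i, j) =
      monomial_mat n (\<lambda>j. z (\<tau> j) * w j) (\<sigma> \<circ> \<tau>) $$ (i, j)"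
    using ij by (simp add: monomial_mat_def)
qed auto

lemma monomial_mat_eqD:
  assumes eq: "monomial_mat n z \<sigma> = monomial_mat n w \<tau>"
    and \<sigma>: "\<sigma> permutes {..<n}" and \<tau>: "\<tau> permutes {..<n}" and z: "\<And>i. i < n \<Longrightarrow> z i \<noteq> 0"
  shows "\<sigma> = \<tau>" and "\<And>i. i < n \<Longrightarrow> z i = w i"
proof -
  have *: "\<sigma> j = \<tau> j \<and> z j = w j" if "j < n" for j
  proof -
    have "monomial_mat n z \<sigma> $$ (\<sigma> j, j) = monomial_mat n w \<tau> $$ (\<sigma> j, j)"
      using eq by simp
    then show ?thesis
      using that z[OF that] permutes_lessThan_less[OF \<sigma> that]
      by (auto simp: monomial_mat_def split: if_splits)
  qed
  show "\<sigma> = \<tau>"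
  proof
    show "\<sigma> j = \<tau> j" for j
      using * permutes_not_in[OF \<sigma>, of j] permutes_not_in[OF \<tau>, of j] by (cases "j < n") auto
  qed
  show "z i = w i" if "i < n" for i
    using * that by blast
qed

lemma monomial_mat_cong:
  assumes "\<And>i. i < n \<Longrightarrow> z i = w i"
  shows "monomial_mat n z \<sigma> = monomial_mat n w \<sigma>"
  using assms by (auto simp: monomial_mat_def intro!: cong_mat)

lemma monomial_mat_one: "monomial_mat n (\<lambda>_. 1) id = 1\<^sub>m n"
  by (auto simp: monomial_mat_def one_mat_def)

lemma monomial_mat_mult_unit_vec:
  assumes "i < n" "\<sigma> i < n"
  shows "monomial_mat n z \<sigma> *\<^sub>v unit_vec n i = z i \<cdot>\<^sub>v unit_vec n (\<sigma> i)"
  using assms by (auto intro!: eq_vecI simp: monomial_mat_def)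

lemma diagonal_mult_vec:
  assumes "v \<in> carrier_vec n"
  shows "monomial_mat n z id *\<^sub>v v = vec n (\<lambda>j. z j * v $ j)"
proof (rule eq_vecI)
  fix i assume "i < dim_vec (vec n (\<lambda>j. z j * v $ j))"
  then have i: "i < n" by simp
  have "(monomial_mat n z id *\<^sub>v v) $ i = (\<Sum>k<n. (if i = k then z k else 0) * v $ k)"
    using i assms by (simp add: monomial_mat_def scalar_prod_def atLeast0LessThan)
  also have "\<dots> = (\<Sum>k<n. if k = i then z k * v $ k else 0)"
    by (rule sum.cong) auto
  finally show "(monomial_mat n z id *\<^sub>v v) $ i = vec n (\<lambda>j. z j * v $ j) $ i"
    using i by simp
qed auto

lemma mat_trace_monomial_mat:
  "mat_trace (monomial_mat n z \<sigma>) = (\<Sum>i<n. if i = \<sigma> i then z i else 0)"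
  by (simp add: mat_trace_def monomial_mat_def)

section \<open>Groups of monomial matrices\<close>

text \<open>The general linear group over the complex numbers.\<close>

abbreviation GL :: "nat \<Rightarrow> complex mat monoid" where
  "GL n \<equiv> units_of (ring_mat TYPE(complex) n ())"

lemma GL_simps: "x \<otimes>\<^bsub>GL n\<^esub> y = x * y" "one (GL n) = 1\<^sub>m n"
  by (simp_all add: units_of_def ring_mat_simps)

lemma group_GL: "group (GL n)"
  using monoid.units_group[OF ring.is_monoid[OF ring_mat]] .

text \<open>A group of permutations of \<open>{..<n}\<close>. Closure under inverses is not required explicitly, since
  permutations of a finite set have finite order (\<open>perm_group_inv\<close>).\<close>

definition perm_group :: "nat \<Rightarrow> (nat \<Rightarrow> nat) set \<Rightarrow> bool" where
  "perm_group n S \<longleftrightarrow> S \<subseteq> {\<sigma>. \<sigma> permutes {..<n}} \<and> id \<in> S \<and> (\<forall>\<sigma>\<in>S. \<forall>\<tau>\<in>S. \<sigma> \<circ> \<tau> \<in> S)"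

text \<open>The monomial matrices with permutation part in \<open>S\<close> and nonzero entries \<open>m\<close>-th roots of unity;
  for \<open>S\<close> the full symmetric group this is the complex reflection group \<open>G(m, 1, n)\<close>, that is, the
  wreath product of a cyclic group of order \<open>m\<close> with the symmetric group.\<close>

definition monomial_group :: "nat \<Rightarrow> nat \<Rightarrow> (nat \<Rightarrow> nat) set \<Rightarrow> complex mat set" where
  "monomial_group n m S = {monomial_mat n z \<sigma> | z \<sigma>. (\<forall>i<n. z i ^ m = 1) \<and> \<sigma> \<in> S}"

lemma monomial_groupI:
  "(\<And>i. i < n \<Longrightarrow> z i ^ m = 1) \<Longrightarrow> \<sigma> \<in> S \<Longrightarrow> monomial_mat n z \<sigma> \<in> monomial_group n m S"
  unfolding monomial_group_def by blast

lemma perm_group_permutes: "perm_group n S \<Longrightarrow> \<sigma> \<in> S \<Longrightarrow> \<sigma> permutes {..<n}"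
  by (auto simp: perm_group_def)

lemma perm_group_funpow:
  assumes "perm_group n S" "\<sigma> \<in> S" shows "\<sigma> ^^ k \<in> S"
  using assms by (induction k) (auto simp: perm_group_def)

lemma perm_group_inv:
  assumes S: "perm_group n S" and \<sigma>: "\<sigma> \<in> S"
  shows "inv_into UNIV \<sigma> \<in> S"
proof -
  have p: "\<sigma> permutes {..<n}" using perm_group_permutes[OF assms] .
  then obtain k where k: "k > 0" "\<sigma> ^^ k = id"
    using permutation_is_nilpotent[of \<sigma>] permutation_permutes by blast
  have "\<sigma> ^^ (k - 1) \<circ> \<sigma> = id"
    using k by (metis Suc_pred' funpow_Suc_right)
  then have "inv_into UNIV \<sigma> = \<sigma> ^^ (k - 1)"
    using permutes_inv_o(1)[OF p] by (metis comp_assoc comp_id id_comp)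
  then show ?thesis using perm_group_funpow[OF assms] by simp
qed

lemma root_nonzero: "m > 0 \<Longrightarrow> z ^ m = 1 \<Longrightarrow> z \<noteq> 0" for z :: complex
  by (auto simp: power_0_left)

lemma monomial_group_mult:
  assumes "perm_group n S" "a \<in> monomial_group n m S" "b \<in> monomial_group n m S"
  shows "a * b \<in> monomial_group n m S"
proof -
  obtain z \<sigma> w \<tau> where a: "a = monomial_mat n z \<sigma>" "\<forall>i<n. z i ^ m = 1" "\<sigma> \<in> S"
    and b: "b = monomial_mat n w \<tau>" "\<forall>i<n. w i ^ m = 1" "\<tau> \<in> S"
    using assms(2,3) by (auto simp: monomial_group_def)
  have \<tau>: "\<tau> permutes {..<n}" using perm_group_permutes[OF assms(1) b(3)] .
  have "a * b = monomial_mat n (\<lambda>j. z (\<tau> j) * w j) (\<sigma> \<circ> \<tau>)"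
    unfolding a b by (rule monomial_mat_mult[OF \<tau>])
  moreover have "\<sigma> \<circ> \<tau> \<in> S" using assms(1) a b by (auto simp: perm_group_def)
  moreover have "\<forall>j<n. (z (\<tau> j) * w j) ^ m = 1"
    using a b permutes_lessThan_less[OF \<tau>] by (auto simp: power_mult_distrib)
  ultimately show ?thesis unfolding monomial_group_def by blast
qed

lemma monomial_group_inverse:
  assumes S: "perm_group n S" and m: "m > 0" and a: "a \<in> monomial_group n m S"
  shows "\<exists>b \<in> monomial_group n m S. a * b = 1\<^sub>m n \<and> b * a = 1\<^sub>m n"
proof -
  obtain z \<sigma> where a: "a = monomial_mat n z \<sigma>" "\<forall>i<n. z i ^ m = 1" "\<sigma> \<in> S"
    using a by (auto simp: monomial_group_def)
  have \<sigma>: "\<sigma> permutes {..<n}" using perm_group_permutes[OF S a(3)] .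
  have \<sigma>i: "inv_into UNIV \<sigma> permutes {..<n}" using permutes_inv[OF \<sigma>] .
  define b where "b = monomial_mat n (\<lambda>i. inverse (z (inv_into UNIV \<sigma> i))) (inv_into UNIV \<sigma>)"
  have nz: "z i \<noteq> 0" if "i < n" for i using a(2) that root_nonzero[OF m] by blast
  have "b \<in> monomial_group n m S"
    unfolding b_def monomial_group_def
    using perm_group_inv[OF S a(3)] a(2) permutes_lessThan_less[OF \<sigma>i]
    by (auto simp: power_inverse intro!: exI)
  moreover have "a * b = monomial_mat n (\<lambda>_. 1) id"
    unfolding a b_def monomial_mat_mult[OF \<sigma>i] permutes_inv_o(1)[OF \<sigma>]
    using nz permutes_lessThan_less[OF \<sigma>i] by (intro monomial_mat_cong) auto
  moreover have "b * a = monomial_mat n (\<lambda>_. 1) id"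
    unfolding a b_def monomial_mat_mult[OF \<sigma>] permutes_inv_o(2)[OF \<sigma>]
    using nz permutes_inverses[OF \<sigma>] by (intro monomial_mat_cong) auto
  ultimately show ?thesis by (auto simp: monomial_mat_one)
qed

lemma monomial_group_subgroup:
  assumes S: "perm_group n S" and m: "m > 0"
  shows "subgroup (monomial_group n m S) (GL n)"
proof -
  interpret group "GL n" by (rule group_GL)
  have carr: "a \<in> carrier_mat n n" if "a \<in> monomial_group n m S" for a
    using that by (auto simp: monomial_group_def)
  have sub: "monomial_group n m S \<subseteq> carrier (GL n)"
    using monomial_group_inverse[OF S m] carr
    by (force simp: units_of_def Units_def ring_mat_simps)
  show ?thesis
  proof (rule subgroupI)
    have "1\<^sub>m n \<in> monomial_group n m S"
      using S unfolding perm_group_def monomial_group_def monomial_mat_one[symmetric]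
      by (intro CollectI exI[of _ "\<lambda>_. 1"] exI[of _ id]) simp
    then show "monomial_group n m S \<noteq> {}" by blast
    show "inv\<^bsub>GL n\<^esub> a \<in> monomial_group n m S" if a: "a \<in> monomial_group n m S" for a
    proof -
      obtain b where b: "b \<in> monomial_group n m S" "b * a = 1\<^sub>m n"
        using monomial_group_inverse[OF S m a] by blast
      then have "inv\<^bsub>GL n\<^esub> a = b"
        using sub a by (intro inv_equality) (auto simp: GL_simps)
      then show ?thesis using b by simp
    qed
  qed (use sub monomial_group_mult[OF S] in \<open>auto simp: GL_simps\<close>)
qed

lemma monomial_group_pow:
  assumes S: "perm_group n S" and \<sigma>: "\<sigma> \<in> S" and z: "\<forall>i<n. z i ^ m = 1"
  shows "\<exists>w. (\<forall>i<n. w i ^ m = 1) \<and> monomial_mat n z \<sigma> [^]\<^bsub>GL n\<^esub> k = monomial_mat n w (\<sigma> ^^ k)"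
proof (induction k)
  case 0
  have "\<exists>w. (\<forall>i<n. w i ^ m = 1) \<and> 1\<^sub>m n = monomial_mat n w id"
    by (rule exI[of _ "\<lambda>_. 1"]) (simp add: monomial_mat_one)
  then show ?case by (simp add: nat_pow_def GL_simps id_def)
next
  case (Suc k)
  then obtain w where w: "\<forall>i<n. w i ^ m = 1"
    "monomial_mat n z \<sigma> [^]\<^bsub>GL n\<^esub> k = monomial_mat n w (\<sigma> ^^ k)" by blast
  have p: "\<sigma> permutes {..<n}" using perm_group_permutes[OF S \<sigma>] .
  have "monomial_mat n z \<sigma> [^]\<^bsub>GL n\<^esub> Suc k = monomial_mat n w (\<sigma> ^^ k) * monomial_mat n z \<sigma>"
    by (simp only: monoid.nat_pow_Suc[OF group.is_monoid[OF group_GL]] w(2) GL_simps)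
  also have "\<dots> = monomial_mat n (\<lambda>j. w (\<sigma> j) * z j) (\<sigma> ^^ Suc k)"
    by (simp only: monomial_mat_mult[OF p] funpow_Suc_right)
  finally show ?case
    using w(1) z permutes_lessThan_less[OF p]
    by (intro exI[of _ "\<lambda>j. w (\<sigma> j) * z j"]) (simp add: power_mult_distrib del: funpow.simps)
qed

lemma diagonal_pow:
  "monomial_mat n z id [^]\<^bsub>GL n\<^esub> k = monomial_mat n (\<lambda>i. z i ^ k) id"
proof (induction k)
  interpret group "GL n" by (rule group_GL)
  case 0
  show ?case by (simp add: GL_simps monomial_mat_one[unfolded id_def])
next
  case (Suc k)
  have "monomial_mat n z id [^]\<^bsub>GL n\<^esub> Suc k = monomial_mat n (\<lambda>i. z i ^ k) id * monomial_mat n z id"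
    by (simp only: monoid.nat_pow_Suc[OF group.is_monoid[OF group_GL]] Suc GL_simps)
  also have "\<dots> = monomial_mat n (\<lambda>j. z (id j) ^ k * z j) (id \<circ> id)"
    by (rule monomial_mat_mult[OF permutes_id])
  finally show ?case by (simp only: id_def comp_def power_Suc2)
qed

lemma monomial_mat_pow_eq_one:
  assumes S: "perm_group n S" and m: "m > 0" and \<sigma>: "\<sigma> \<in> S" "\<sigma> ^^ k = id"
    and z: "\<forall>i<n. z i ^ m = 1"
  shows "monomial_mat n z \<sigma> [^]\<^bsub>GL n\<^esub> (k * m) = 1\<^sub>m n"
proof -
  interpret group "GL n" by (rule group_GL)
  have carr: "monomial_mat n z \<sigma> \<in> carrier (GL n)"
    using subgroup.subset[OF monomial_group_subgroup[OF S m]] \<sigma> z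
    by (auto simp: monomial_group_def)
  obtain w where w: "\<forall>i<n. w i ^ m = 1" "monomial_mat n z \<sigma> [^]\<^bsub>GL n\<^esub> k = monomial_mat n w id"
    using monomial_group_pow[OF S \<sigma>(1) z, of k] \<sigma>(2) by auto
  have "monomial_mat n z \<sigma> [^]\<^bsub>GL n\<^esub> (k * m) = monomial_mat n w id [^]\<^bsub>GL n\<^esub> m"
    using nat_pow_pow[OF carr, of k m] w(2) by simp
  also have "\<dots> = monomial_mat n (\<lambda>_. 1) id"
    unfolding diagonal_pow using w(1) by (intro monomial_mat_cong) auto
  finally show ?thesis by (simp add: monomial_mat_one)
qed

text \<open>The hypothesis \<open>comm\<close> says that all commutators \<open>\<rho> = \<sigma> \<tau> \<sigma>\<^sup>-\<^sup>1 \<tau>\<^sup>-\<^sup>1\<close> of elements of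
  \<open>S\<close> lie in \<open>T\<close>, written without inverses. The permutation part of a commutator of monomial
  matrices is the commutator of the permutation parts.\<close>

lemma monomial_group_solvable_step:
  assumes S: "perm_group n S" and m: "m > 0"
    and T: "solvable_seq (GL n) (monomial_group n m T)"
    and comm: "\<And>\<rho> \<sigma> \<tau>. \<rho> \<in> S \<Longrightarrow> \<sigma> \<in> S \<Longrightarrow> \<tau> \<in> S \<Longrightarrow> \<rho> \<circ> (\<tau> \<circ> \<sigma>) = \<sigma> \<circ> \<tau> \<Longrightarrow> \<rho> \<in> T"
  shows "solvable_seq (GL n) (monomial_group n m S)"
proof -
  interpret group "GL n" by (rule group_GL)
  interpret H: subgroup "monomial_group n m S" "GL n" by (rule monomial_group_subgroup[OF S m])
  show ?thesis
  proof (rule solvable_seq_of_commutators[OF H.subgroup_axioms T])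
    fix x y assume xy: "x \<in> monomial_group n m S" "y \<in> monomial_group n m S"
    define c where "c = x \<otimes>\<^bsub>GL n\<^esub> y \<otimes>\<^bsub>GL n\<^esub> inv\<^bsub>GL n\<^esub> x \<otimes>\<^bsub>GL n\<^esub> inv\<^bsub>GL n\<^esub> y"
    have c: "c \<in> monomial_group n m S" using xy by (simp add: c_def)
    have "c \<otimes>\<^bsub>GL n\<^esub> (y \<otimes>\<^bsub>GL n\<^esub> x) = x \<otimes>\<^bsub>GL n\<^esub> y"
    proof -
      have xyc: "x \<in> carrier (GL n)" "y \<in> carrier (GL n)" using xy by auto
      then have "inv\<^bsub>GL n\<^esub> y \<otimes>\<^bsub>GL n\<^esub> (y \<otimes>\<^bsub>GL n\<^esub> x) = x"
        by (simp flip: m_assoc)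
      then show ?thesis using xyc by (simp add: c_def m_assoc)
    qed
    then have eq: "c * (y * x) = x * y" by (simp add: GL_simps)
    obtain z \<sigma> where x: "x = monomial_mat n z \<sigma>" "\<forall>i<n. z i ^ m = 1" "\<sigma> \<in> S"
      using xy by (auto simp: monomial_group_def)
    obtain w \<tau> where y: "y = monomial_mat n w \<tau>" "\<forall>i<n. w i ^ m = 1" "\<tau> \<in> S"
      using xy by (auto simp: monomial_group_def)
    obtain u \<rho> where c': "c = monomial_mat n u \<rho>" "\<forall>i<n. u i ^ m = 1" "\<rho> \<in> S"
      using c by (auto simp: monomial_group_def)
    have p: "\<sigma> permutes {..<n}" "\<tau> permutes {..<n}" "\<rho> permutes {..<n}"
      using perm_group_permutes[OF S] x y c' by auto
    note lt = permutes_lessThan_less[OF p(1)] permutes_lessThan_less[OF p(2)]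
    have "monomial_mat n (\<lambda>j. z (\<tau> j) * w j) (\<sigma> \<circ> \<tau>) =
        monomial_mat n (\<lambda>j. u ((\<tau> \<circ> \<sigma>) j) * (w (\<sigma> j) * z j)) (\<rho> \<circ> (\<tau> \<circ> \<sigma>))"
      using eq unfolding x y c'
      by (simp only: monomial_mat_mult[OF p(1)] monomial_mat_mult[OF p(2)]
          monomial_mat_mult[OF permutes_compose[OF p(1,2)]])
    then have "\<sigma> \<circ> \<tau> = \<rho> \<circ> (\<tau> \<circ> \<sigma>)"
      using x(2) y(2) lt root_nonzero[OF m] p
      by (intro monomial_mat_eqD(1)) (auto intro!: permutes_compose)
    then have "\<rho> \<in> T" using comm x y c' by metis
    then show "x \<otimes>\<^bsub>GL n\<^esub> y \<otimes>\<^bsub>GL n\<^esub> inv\<^bsub>GL n\<^esub> x \<otimes>\<^bsub>GL n\<^esub> inv\<^bsub>GL n\<^esub> y \<in> monomial_group n m T"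
      using c' unfolding c_def[symmetric] by (auto simp: monomial_group_def)
  qed
qed

lemma diagonal_group_solvable:
  assumes m: "m > 0"
  shows "solvable_seq (GL n) (monomial_group n m {id})"
proof -
  interpret group "GL n" by (rule group_GL)
  have S: "perm_group n {id}" by (simp add: perm_group_def permutes_id)
  interpret H: subgroup "monomial_group n m {id}" "GL n" by (rule monomial_group_subgroup[OF S m])
  show ?thesis
  proof (rule solvable_seq_of_commutators[OF H.subgroup_axioms solvable_seq.unity])
    fix x y assume xy: "x \<in> monomial_group n m {id}" "y \<in> monomial_group n m {id}"
    then have "x * y = y * x"
      by (auto simp: monomial_group_def monomial_mat_mult[OF permutes_id] mult.commute)
    then have "x \<otimes>\<^bsub>GL n\<^esub> y = y \<otimes>\<^bsub>GL n\<^esub> x" by (simp add: GL_simps)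
    then show "x \<otimes>\<^bsub>GL n\<^esub> y \<otimes>\<^bsub>GL n\<^esub> inv\<^bsub>GL n\<^esub> x \<otimes>\<^bsub>GL n\<^esub> inv\<^bsub>GL n\<^esub> y \<in> {\<one>\<^bsub>GL n\<^esub>}"
      using xy by (simp add: m_assoc)
  qed
qed

lemma card_monomial_group:
  assumes m: "m > 0" and S: "perm_group n S"
  shows "finite (monomial_group n m S)" "card (monomial_group n m S) = m ^ n * card S"
proof -
  define U where "U = {z :: complex. z ^ m = 1}"
  define D where "D = ({..<n} \<rightarrow>\<^sub>E U) \<times> S"
  have U: "finite U" "card U = m"
    using m card_roots_unity_eq[OF m] finite_roots_unity[of m] by (auto simp: U_def)
  have fS: "finite S"
    by (rule finite_subset[of _ "{\<sigma>. \<sigma> permutes {..<n}}"])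
      (use S in \<open>auto simp: perm_group_def finite_permutations\<close>)
  have img: "monomial_group n m S = (\<lambda>(z, \<sigma>). monomial_mat n z \<sigma>) ` D"
  proof (intro equalityI subsetI)
    fix a assume "a \<in> monomial_group n m S"
    then obtain z \<sigma> where a: "a = monomial_mat n z \<sigma>" "\<forall>i<n. z i ^ m = 1" "\<sigma> \<in> S"
      by (auto simp: monomial_group_def)
    have "a = monomial_mat n (restrict z {..<n}) \<sigma>"
      unfolding a by (rule monomial_mat_cong) simp
    moreover have "(restrict z {..<n}, \<sigma>) \<in> D"
      using a by (auto simp: D_def U_def)
    ultimately show "a \<in> (\<lambda>(z, \<sigma>). monomial_mat n z \<sigma>) ` D" by force
  next
    fix a assume "a \<in> (\<lambda>(z, \<sigma>). monomial_mat n z \<sigma>) ` D"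
    then show "a \<in> monomial_group n m S"
      by (force simp: D_def U_def monomial_group_def PiE_iff)
  qed
  have inj: "inj_on (\<lambda>(z, \<sigma>). monomial_mat n z \<sigma>) D"
  proof (rule inj_onI, clarify)
    fix z \<sigma> w \<tau>
    assume D: "(z, \<sigma>) \<in> D" "(w, \<tau>) \<in> D" and eq: "monomial_mat n z \<sigma> = monomial_mat n w \<tau>"
    have p: "\<sigma> permutes {..<n}" "\<tau> permutes {..<n}"
      using D perm_group_permutes[OF S] by (auto simp: D_def)
    have nz: "z i \<noteq> 0" if "i < n" for i
      using D that root_nonzero[OF m, of "z i"] by (auto simp: D_def U_def PiE_iff)
    have "z = w"
      using D monomial_mat_eqD(2)[OF eq p nz] by (intro PiE_ext[of z "{..<n}" "\<lambda>_. U"]) (auto simp: D_def)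
    with monomial_mat_eqD(1)[OF eq p nz] show "z = w \<and> \<sigma> = \<tau>" by blast
  qed
  show "finite (monomial_group n m S)"
    unfolding img D_def using U fS by (intro finite_imageI finite_cartesian_product finite_PiE) auto
  show "card (monomial_group n m S) = m ^ n * card S"
    using U card_image[OF inj] by (simp only: img) (simp add: D_def card_cartesian_product card_PiE)
qed

section \<open>The natural character\<close>

lemma monomial_group_irreducible:
  assumes S: "perm_group n S" and trans: "\<And>i j. i < n \<Longrightarrow> j < n \<Longrightarrow> \<exists>\<sigma>\<in>S. \<sigma> i = j"
    and m: "m > 1"
    and W: "subspace class_ring W (module_vec TYPE(complex) n)"
    and inv: "\<And>a w. a \<in> monomial_group n m S \<Longrightarrow> w \<in> W \<Longrightarrow> a *\<^sub>v w \<in> W"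
  shows "W = {0\<^sub>v n} \<or> W = carrier_vec n"
proof (rule disjCI)
  have sm: "submodule class_ring W (module_vec TYPE(complex) n)"
    using W by (simp add: subspace_def)
  have sub: "W \<subseteq> carrier_vec n" and zero: "0\<^sub>v n \<in> W"
    and add: "\<And>v w. v \<in> W \<Longrightarrow> w \<in> W \<Longrightarrow> v + w \<in> W"
    and smult: "\<And>c w. w \<in> W \<Longrightarrow> c \<cdot>\<^sub>v w \<in> W"
    using submodule.subset[OF sm] submodule.zero_closed[OF sm] submodule.m_closed[OF sm]
      submodule.smult_closed[OF sm] by (auto simp: module_vec_simps)
  assume "W \<noteq> carrier_vec n"
  show "W = {0\<^sub>v n}"
  proof (rule ccontr)
    assume "W \<noteq> {0\<^sub>v n}"
    then obtain w where w: "w \<in> W" "w \<noteq> 0\<^sub>v n" using zero by blast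
    have wc: "w \<in> carrier_vec n" using w sub by blast
    then obtain i where i: "i < n" "w $ i \<noteq> 0"
      using w(2) by (metis carrier_vecD eq_vecI index_zero_vec)
    have "\<not> {z :: complex. z ^ m = 1} \<subseteq> {1}"
      using card_mono[of "{1}" "{z :: complex. z ^ m = 1}"] card_roots_unity_eq[of m] m by auto
    then obtain \<omega> :: complex where \<omega>: "\<omega> ^ m = 1" "\<omega> \<noteq> 1" by blast
    \<comment> \<open>\<open>d\<close> multiplies only the \<open>i\<close>-th coordinate of \<open>w\<close>, so \<open>d w - w\<close> is a multiple of the
      \<open>i\<close>-th basis vector.\<close>
    define d where "d = monomial_mat n ((\<lambda>_. 1)(i := \<omega>)) id"
    have "d \<in> monomial_group n m S"
      using S \<omega> by (auto simp: d_def monomial_group_def perm_group_def intro!: exI)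
    then have "d *\<^sub>v w + (-1) \<cdot>\<^sub>v w \<in> W" using inv w add smult by blast
    then have "(1 / ((\<omega> - 1) * w $ i)) \<cdot>\<^sub>v (d *\<^sub>v w + (-1) \<cdot>\<^sub>v w) \<in> W" by (rule smult)
    moreover have "(1 / ((\<omega> - 1) * w $ i)) \<cdot>\<^sub>v (d *\<^sub>v w + (-1) \<cdot>\<^sub>v w) = unit_vec n i"
      using i \<omega>(2) wc by (auto intro!: eq_vecI simp: d_def diagonal_mult_vec field_simps)
    ultimately have ei: "unit_vec n i \<in> W" by simp
    have ej: "unit_vec n j \<in> W" if j: "j < n" for j
    proof -
      obtain \<sigma> where \<sigma>: "\<sigma> \<in> S" "\<sigma> i = j" using trans[OF i(1) j] by blast
      have "monomial_mat n (\<lambda>_. 1) \<sigma> \<in> monomial_group n m S"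
        using \<sigma> by (intro monomial_groupI) simp_all
      then have "monomial_mat n (\<lambda>_. 1) \<sigma> *\<^sub>v unit_vec n i \<in> W" by (rule inv[OF _ ei])
      then show ?thesis using monomial_mat_mult_unit_vec[of i n \<sigma> "\<lambda>_. 1"] i(1) \<sigma>(2) j by simp
    qed
    have "v \<in> W" if v: "v \<in> carrier_vec n" for v
    proof -
      \<comment> \<open>Building up \<open>v\<close> one coordinate at a time.\<close>
      have "vec n (\<lambda>j. if j < k then v $ j else 0) \<in> W" if "k \<le> n" for k
        using that
      proof (induction k)
        case 0
        have "vec n (\<lambda>j. if j < 0 then v $ j else 0) = 0\<^sub>v n" by auto
        then show ?case using zero by simp
      next
        case (Suc k)
        have "vec n (\<lambda>j. if j < Suc k then v $ j else 0) =
            vec n (\<lambda>j. if j < k then v $ j else 0) + v $ k \<cdot>\<^sub>v unit_vec n k"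
          using Suc.prems by (auto intro!: eq_vecI simp: less_Suc_eq)
        then show ?case using Suc by (simp add: add smult ej)
      qed
      from this[of n] have "vec n (\<lambda>j. if j < n then v $ j else 0) \<in> W" by simp
      moreover have "vec n (\<lambda>j. if j < n then v $ j else 0) = v" using v by auto
      ultimately show ?thesis by simp
    qed
    then show False using sub \<open>W \<noteq> carrier_vec n\<close> by blast
  qed
qed

lemma monomial_group_faithful:
  assumes S: "perm_group n S" and m: "m > 0" and a: "a \<in> monomial_group n m S"
    and tr: "mat_trace a = of_nat n"
  shows "a = 1\<^sub>m n"
proof -
  obtain z \<sigma> where a: "a = monomial_mat n z \<sigma>" "\<forall>i<n. z i ^ m = 1" "\<sigma> \<in> S"
    using a by (auto simp: monomial_group_def)
  define t where "t i = (if i = \<sigma> i then z i else 0)" for i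
  have norm: "norm (z i) = 1" if "i < n" for i
    using a(2) that m power_eq_1_iff[of "z i" m] by auto
  \<comment> \<open>The \<open>n\<close> diagonal entries \<open>t i\<close> have real part at most 1 and the sum of their real parts
    is \<open>n\<close>, so each of them is 1.\<close>
  have le: "Re (t i) \<le> 1" if "i < n" for i
    using norm[OF that] complex_Re_le_cmod[of "z i"] by (auto simp: t_def)
  have "(\<Sum>i<n. 1 - Re (t i)) = 0"
    using arg_cong[OF tr, of Re] by (simp add: a(1) mat_trace_monomial_mat sum_subtractf t_def)
  then have "\<forall>i<n. Re (t i) = 1"
    using le by (subst (asm) sum_nonneg_eq_0_iff) auto
  then have *: "\<sigma> i = i \<and> z i = 1" if "i < n" for i
    using that norm[OF that] by (auto simp: t_def cmod_def complex_eq_iff split: if_splits)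
  have "a = monomial_mat n (\<lambda>_. 1) \<sigma>"
    unfolding a by (rule monomial_mat_cong) (use * in auto)
  also have "\<sigma> = id"
  proof
    show "\<sigma> i = id i" for i
      using * permutes_not_in[OF perm_group_permutes[OF S a(3)], of i] by (cases "i < n") auto
  qed
  finally show ?thesis by (simp only: monomial_mat_one)
qed

section \<open>Permutations of four points\<close>

text \<open>A permutation \<open>\<sigma>\<close> of \<open>{..<4}\<close> is represented by the list of its values
  \<open>map \<sigma> [0..<4]\<close>, so that facts about all permutations become finite computations with lists.
  Composition of permutations corresponds to \<open>comp_list\<close>.\<close>

definition comp_list :: "nat list \<Rightarrow> nat list \<Rightarrow> nat list" where
  "comp_list p q = map ((!) p) q"

text \<open>The value lists of the elements of \<open>S\<^sub>4\<close>, of \<open>A\<^sub>4\<close>, and of its normal Klein four-subgroup.\<close>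

definition sym4 :: "nat list list" where
  "sym4 = filter distinct (List.n_lists 4 [0..<4])"

definition alt4 :: "nat list list" where
  "alt4 = [[0,1,2,3], [1,0,3,2], [2,3,0,1], [3,2,1,0], [0,2,3,1], [0,3,1,2],
           [2,1,3,0], [3,1,0,2], [1,3,2,0], [3,0,2,1], [1,2,0,3], [2,0,1,3]]"

definition klein4 :: "nat list list" where
  "klein4 = [[0,1,2,3], [1,0,3,2], [2,3,0,1], [3,2,1,0]]"

text \<open>The permutations of four points whose value list occurs in \<open>L\<close>.\<close>

definition perms_of :: "nat list list \<Rightarrow> (nat \<Rightarrow> nat) set" where
  "perms_of L = {\<sigma>. \<sigma> permutes {..<4} \<and> map \<sigma> [0..<4] \<in> set L}"

lemma map_comp_perm:
  assumes "\<tau> permutes {..<4}"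
  shows "map (\<sigma> \<circ> \<tau>) [0..<4] = comp_list (map \<sigma> [0..<4]) (map \<tau> [0..<4])"
  using permutes_lessThan_less[OF assms] by (auto simp: comp_list_def)

lemma map_perm_inj:
  assumes "\<sigma> permutes {..<4}" "\<tau> permutes {..<4}" "map \<sigma> [0..<4] = map \<tau> [0..<4]"
  shows "\<sigma> = \<tau>"
proof
  show "\<sigma> i = \<tau> i" for i
    using assms(3) permutes_not_in[OF assms(1), of i] permutes_not_in[OF assms(2), of i]
    by (cases "i < 4") (auto simp: map_eq_conv)
qed

lemma perms_of_sym4: "perms_of sym4 = {\<sigma>. \<sigma> permutes {..<4}}"
proof -
  have "map \<sigma> [0..<4] \<in> set sym4" if "\<sigma> permutes {..<4}" for \<sigma>
    using permutes_lessThan_less[OF that] permutes_inj_on[OF that, of "{0..<4}"]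
    by (auto simp: sym4_def set_n_lists distinct_map atLeast0LessThan)
  then show ?thesis by (auto simp: perms_of_def)
qed

lemma perm_group_perms_of:
  assumes "[0,1,2,3] \<in> set L" and "\<forall>p\<in>set L. \<forall>q\<in>set L. comp_list p q \<in> set L"
  shows "perm_group 4 (perms_of L)"
proof -
  have "map id [0..<4] = [0,1,2,3::nat]" by (simp add: upt_rec)
  then have "id \<in> perms_of L" using assms(1) by (simp only: perms_of_def mem_Collect_eq permutes_id)
  moreover have "\<sigma> \<circ> \<tau> \<in> perms_of L" if "\<sigma> \<in> perms_of L" "\<tau> \<in> perms_of L" for \<sigma> \<tau>
    using that assms(2) unfolding perms_of_def mem_Collect_eq
    by (metis map_comp_perm permutes_compose)
  ultimately show ?thesis by (auto simp: perm_group_def perms_of_def)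
qed

text \<open>The commutator of \<open>\<sigma>\<close> and \<open>\<tau>\<close> is the only \<open>\<rho>\<close> with \<open>\<rho> \<tau> \<sigma> = \<sigma> \<tau>\<close>, so it
  suffices to exhibit a solution of this equation in \<open>K\<close>.\<close>

lemma commutators_perms_of:
  assumes L: "\<forall>p\<in>set L. \<forall>q\<in>set L. \<exists>r\<in>set K. comp_list p q = comp_list r (comp_list q p)"
    and K: "\<forall>r\<in>set K. length r = 4"
    and "\<rho> \<in> perms_of L" "\<sigma> \<in> perms_of L" "\<tau> \<in> perms_of L" and eq: "\<rho> \<circ> (\<tau> \<circ> \<sigma>) = \<sigma> \<circ> \<tau>"
  shows "\<rho> \<in> perms_of K"
proof -
  have p: "\<sigma> permutes {..<4}" "\<tau> permutes {..<4}" "\<rho> permutes {..<4}"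
    using assms by (auto simp: perms_of_def)
  have \<tau>\<sigma>: "\<tau> \<circ> \<sigma> permutes {..<4}" by (rule permutes_compose[OF p(1,2)])
  have "map \<sigma> [0..<4] \<in> set L" "map \<tau> [0..<4] \<in> set L"
    using assms(4,5) by (simp_all only: perms_of_def mem_Collect_eq)
  then obtain r where r: "r \<in> set K"
    "comp_list (map \<sigma> [0..<4]) (map \<tau> [0..<4]) =
      comp_list r (comp_list (map \<tau> [0..<4]) (map \<sigma> [0..<4]))"
    using L by blast
  have "map (\<rho> \<circ> (\<tau> \<circ> \<sigma>)) [0..<4] = comp_list r (map (\<tau> \<circ> \<sigma>) [0..<4])"
    using r(2) by (simp only: eq map_comp_perm[OF p(1)] map_comp_perm[OF p(2)])
  then have *: "\<rho> ((\<tau> \<circ> \<sigma>) j) = r ! (\<tau> \<circ> \<sigma>) j" if "j < 4" for j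
    using that unfolding comp_list_def map_map map_eq_conv by auto
  have "map \<rho> [0..<4] = r"
  proof (rule nth_equalityI)
    fix i assume "i < length (map \<rho> [0..<4])"
    then have i: "i < 4" by simp
    define j where "j = inv_into UNIV (\<tau> \<circ> \<sigma>) i"
    have "(\<tau> \<circ> \<sigma>) j = i" unfolding j_def by (rule permutes_inverses(1)[OF \<tau>\<sigma>])
    moreover have "j < 4" unfolding j_def by (rule permutes_lessThan_less[OF permutes_inv[OF \<tau>\<sigma>] i])
    ultimately show "map \<rho> [0..<4] ! i = r ! i" using *[of j] i by simp
  qed (use K r(1) in auto)
  then show ?thesis using r(1) p(3) unfolding perms_of_def by blast
qed

lemma sym4_commutators:
  "\<forall>p\<in>set sym4. \<forall>q\<in>set sym4. \<exists>r\<in>set alt4. comp_list p q = comp_list r (comp_list q p)"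
  by code_simp

lemma alt4_commutators:
  "\<forall>p\<in>set alt4. \<forall>q\<in>set alt4. \<exists>r\<in>set klein4. comp_list p q = comp_list r (comp_list q p)"
  by code_simp

lemma klein4_commutators:
  "\<forall>p\<in>set klein4. \<forall>q\<in>set klein4. \<exists>r\<in>set [[0,1,2,3]]. comp_list p q = comp_list r (comp_list q p)"
  by code_simp

lemma alt4_closed: "\<forall>p\<in>set alt4. \<forall>q\<in>set alt4. comp_list p q \<in> set alt4"
  by code_simp

lemma klein4_closed: "\<forall>p\<in>set klein4. \<forall>q\<in>set klein4. comp_list p q \<in> set klein4"
  by code_simp

lemma sym4_cube_or_fourth_power:
  "\<forall>p\<in>set sym4. comp_list p (comp_list p p) = [0,1,2,3] \<or>
     comp_list p (comp_list p (comp_list p p)) = [0,1,2,3]"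
  by code_simp

lemma perm_group_sym: "perm_group n {\<sigma>. \<sigma> permutes {..<n}}"
  by (auto simp: perm_group_def permutes_id permutes_compose)

lemma perm4_cube_or_fourth_power:
  fixes \<sigma> :: "nat \<Rightarrow> nat"
  assumes p: "\<sigma> permutes {..<4}"
  shows "\<sigma> ^^ 3 = id \<or> \<sigma> ^^ 4 = id"
proof -
  have id: "map id [0..<4] = [0,1,2,3::nat]" by (simp add: upt_rec)
  have m: "map \<sigma> [0..<4] \<in> set sym4" using p perms_of_sym4 by (auto simp: perms_of_def)
  have e: "\<sigma> ^^ 3 = \<sigma> \<circ> (\<sigma> \<circ> \<sigma>)" "\<sigma> ^^ 4 = \<sigma> \<circ> (\<sigma> \<circ> (\<sigma> \<circ> \<sigma>))"
    by (auto simp: numeral_eq_Suc)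
  note pc = permutes_compose[OF p p]
  have "map (\<sigma> ^^ 3) [0..<4] = map id [0..<4] \<or> map (\<sigma> ^^ 4) [0..<4] = map id [0..<4]"
    using sym4_cube_or_fourth_power m
    by (simp only: e map_comp_perm[OF p] map_comp_perm[OF pc] map_comp_perm[OF permutes_compose[OF pc p]] id)
  then show ?thesis
    using map_perm_inj[OF permutes_funpow[OF p] permutes_id] by blast
qed

section \<open>The wreath product of the cyclic group of order five with the symmetric group\<close>

text \<open>The wreath product \<open>C\<^sub>5 wr S\<^sub>4\<close>, that is, \<open>G(5, 1, 4)\<close>.\<close>

abbreviation G54 :: "complex mat set" where
  "G54 \<equiv> monomial_group 4 5 {\<sigma>. \<sigma> permutes {..<4}}"

lemma G54_solvable: "solvable_seq (GL 4) G54"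
proof -
  have len: "\<forall>r\<in>set alt4. length r = 4" "\<forall>r\<in>set klein4. length r = 4"
    "\<forall>r\<in>set [[0,1,2,3 :: nat]]. length r = 4"
    by (simp_all add: alt4_def klein4_def)
  have id: "\<rho> \<in> {id}" if "\<rho> \<in> perms_of [[0,1,2,3]]" for \<rho>
  proof -
    have "\<rho> permutes {..<4}" "map \<rho> [0..<4] = map id [0..<4]"
      using that by (auto simp: perms_of_def upt_rec)
    then show ?thesis using map_perm_inj[OF _ permutes_id] by simp
  qed
  have groups: "perm_group 4 (perms_of alt4)" "perm_group 4 (perms_of klein4)"
    by (rule perm_group_perms_of[OF _ alt4_closed], simp add: alt4_def)
      (rule perm_group_perms_of[OF _ klein4_closed], simp add: klein4_def)
  have K: "solvable_seq (GL 4) (monomial_group 4 5 (perms_of klein4))"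
  proof (rule monomial_group_solvable_step[OF groups(2) _ diagonal_group_solvable])
    show "\<rho> \<in> {id}" if "\<rho> \<in> perms_of klein4" "\<sigma> \<in> perms_of klein4" "\<tau> \<in> perms_of klein4"
      "\<rho> \<circ> (\<tau> \<circ> \<sigma>) = \<sigma> \<circ> \<tau>" for \<rho> \<sigma> \<tau>
      by (rule id[OF commutators_perms_of[OF klein4_commutators len(3) that]])
  qed simp_all
  have A: "solvable_seq (GL 4) (monomial_group 4 5 (perms_of alt4))"
    by (rule monomial_group_solvable_step[OF groups(1) _ K commutators_perms_of[OF alt4_commutators len(2)]])
      simp_all
  show ?thesis
    unfolding perms_of_sym4[symmetric]
    by (rule monomial_group_solvable_step[OF perm_group_sym[of 4, folded perms_of_sym4] _ A
          commutators_perms_of[OF sym4_commutators len(1)]]) simp_all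
qed

lemma G54_pow:
  assumes "a \<in> G54"
  shows "a [^]\<^bsub>GL 4\<^esub> (15::nat) = 1\<^sub>m 4 \<or> a [^]\<^bsub>GL 4\<^esub> (20::nat) = 1\<^sub>m 4"
proof -
  obtain z \<sigma> where a: "a = monomial_mat 4 z \<sigma>" "\<forall>i<4. z i ^ 5 = 1" "\<sigma> permutes {..<4}"
    using assms by (auto simp: monomial_group_def)
  show ?thesis
    using perm4_cube_or_fourth_power[OF a(3)] monomial_mat_pow_eq_one[OF perm_group_sym, of 5 \<sigma> 4 _ z] a
    by fastforce
qed

theorem mainTheorem3:
  shows "\<exists>(G :: nat monoid) \<chi>.
    group G \<and> finite (carrier G) \<and> solvable G \<and> \<chi> \<in> Irr G \<and>
    \<not> (\<exists>g \<in> carrier G. prime_factors (codegree G \<chi>) \<subseteq> prime_factors (group.ord G g))"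
proof -
  define H where "H = (GL 4)\<lparr>carrier := G54\<rparr>"
  interpret GL: group "GL 4" by (rule group_GL)
  have sub: "subgroup G54 (GL 4)" by (rule monomial_group_subgroup[OF perm_group_sym]) simp
  have carH: "carrier H = G54" by (simp add: H_def)
  have "group H" unfolding H_def by (rule GL.subgroup_imp_group[OF sub])
  moreover have "finite (carrier H)"
    using card_monomial_group(1)[OF _ perm_group_sym] by (simp add: carH)
  ultimately obtain G :: "nat monoid" and \<phi> where G: "group G" and \<phi>: "\<phi> \<in> iso G H"
    using finite_group_copy_on_nat by blast
  interpret G: group G by (rule G)
  have bij: "bij_betw \<phi> (carrier G) G54" using \<phi> by (simp add: iso_def carH)
  have fin: "finite (carrier G)"
    using bij_betw_finite[OF bij] card_monomial_group(1)[OF _ perm_group_sym] by simp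
  have card: "card (carrier G) = 15000"
    using bij_betw_same_card[OF bij] card_monomial_group(2)[OF _ perm_group_sym, of 5 4]
      card_permutations[of "{..<4::nat}" 4] by (simp add: fact_numeral)
  have hom: "\<phi> \<in> hom G (GL 4)"
    using \<phi> subgroup.subset[OF sub] by (auto simp: iso_def hom_def H_def)
  interpret \<phi>: group_hom G "GL 4" \<phi>
    using hom by (intro group_hom.intro group_hom_axioms.intro) unfold_locales
  have inj: "inj_on \<phi> (carrier G)" and img: "\<phi> ` carrier G = G54"
    using bij by (auto simp: bij_betw_def)
  have solv: "solvable G"
    unfolding solvable_def
    using \<phi>.solvable_img_imp_solvable[OF G.subgroup_self inj] img G54_solvable by simp
  have irr: "is_irreducible_representation G 4 \<phi>"
    unfolding is_irreducible_representation_def is_representation_def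
  proof (intro conjI allI impI hom)
    fix W :: "complex vec set"
    assume W: "subspace class_ring W (module_vec TYPE(complex) 4) \<and>
      (\<forall>g\<in>carrier G. \<forall>w\<in>W. \<phi> g *\<^sub>v w \<in> W)"
    have "\<exists>\<sigma>\<in>{\<sigma>. \<sigma> permutes {..<4}}. \<sigma> i = j" if "i < 4" "j < 4" for i j :: nat
      using that permutes_swap_id[of i "{..<4}" j] by (intro bexI[of _ "transpose i j"]) auto
    then show "W = {0\<^sub>v 4} \<or> W = carrier_vec 4"
      using W by (intro monomial_group_irreducible[OF perm_group_sym, of 4 5]) (auto simp flip: img)
  qed simp
  define \<chi> where "\<chi> = character_of G \<phi>"
  have \<chi>: "\<chi> \<in> Irr G" using irr by (auto simp: Irr_def \<chi>_def)
  have one: "\<phi> \<one>\<^bsub>G\<^esub> = 1\<^sub>m 4" using \<phi>.hom_one by (simp add: GL_simps)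
  have \<chi>1: "\<chi> \<one>\<^bsub>G\<^esub> = 4"
    by (simp add: \<chi>_def character_of_def one mat_trace_def del: \<phi>.hom_one)
  have "char_kernel G \<chi> = {\<one>\<^bsub>G\<^esub>}"
  proof (intro equalityI subsetI)
    fix g assume "g \<in> char_kernel G \<chi>"
    then have g: "g \<in> carrier G" "\<chi> g = 4" using \<chi>1 by (auto simp: char_kernel_def)
    have "\<phi> g = 1\<^sub>m 4"
      using g img by (intro monomial_group_faithful[OF perm_group_sym, of 5])
        (auto simp: \<chi>_def character_of_def)
    then show "g \<in> {\<one>\<^bsub>G\<^esub>}"
      using inj_onD[OF inj, of g "\<one>\<^bsub>G\<^esub>"] one g by simp
  qed (auto simp: char_kernel_def)
  then have "card (rcosets\<^bsub>G\<^esub> (char_kernel G \<chi>)) = 15000"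
    using G.lagrange_finite[OF fin G.triv_subgroup] card by (simp add: Coset.order_def)
  then have cod: "codegree G \<chi> = 3750"
    by (intro codegree_eqI) (simp_all add: \<chi>1)
  have "\<not> prime_factors (codegree G \<chi>) \<subseteq> prime_factors (G.ord g)" if g: "g \<in> carrier G" for g
  proof
    assume "prime_factors (codegree G \<chi>) \<subseteq> prime_factors (G.ord g)"
    moreover have "2 \<in> prime_factors (3750 :: nat)" "3 \<in> prime_factors (3750 :: nat)"
      by (simp_all add: prime_factors_dvd)
    ultimately have *: "2 dvd G.ord g" "3 dvd G.ord g"
      unfolding cod by auto
    have "\<phi> (g [^]\<^bsub>G\<^esub> (15::nat)) = \<phi> \<one>\<^bsub>G\<^esub> \<or> \<phi> (g [^]\<^bsub>G\<^esub> (20::nat)) = \<phi> \<one>\<^bsub>G\<^esub>"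
    proof -
      have "\<phi> g \<in> G54" using g img by blast
      then show ?thesis using G54_pow[of "\<phi> g"] by (simp add: \<phi>.hom_nat_pow g GL_simps)
    qed
    then have "g [^]\<^bsub>G\<^esub> (15::nat) = \<one>\<^bsub>G\<^esub> \<or> g [^]\<^bsub>G\<^esub> (20::nat) = \<one>\<^bsub>G\<^esub>"
      using inj_onD[OF inj] g by blast
    then have "G.ord g dvd 15 \<or> G.ord g dvd 20" using G.pow_eq_id[OF g] by simp
    then have "2 dvd (15::nat) \<or> 3 dvd (20::nat)" using * dvd_trans by blast
    then show False by simp
  qed
  then show ?thesis using G fin solv \<chi> by blast
qed

end
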